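(* Let an instance of the minimax regret scheduling problem be given: jobs $J=\{1,\dots,n\}$ with $n\ge 2$, unrelated machines $M=\{1,\dots,m\}$, processing times $p_{i,j}>0$, and release date intervals $R_j=[r_j^-,r_j^+]$ with $0\le r_j^-<r_j^+$. If there exists a job $j\in J$ such that $$\max_{k\in J\setminus\{j\}} r_k^+ +\sum_{k\in J\setminus\{j\}}\max_{i=1,\dots,m}p_{i,k}\le r_j^-,$$ then the schedule $x_{\mathrm{PM}}$ produced by the Partial\_Makespan algorithm is optimal for the minimax regret problem, i.e. $Z(x_{\mathrm{PM}})=\min_x Z(x)$.
   Context: Jobs $J=\{1,\dots,n\}$ are independent and non-preemptive and are processed on unrelated parallel machines $M=\{1,\dots,m\}$; $p_{i,j}>0$ is the processing time of job $j$ on machine $i$. The release date $r_j$ of job $j$ lies in $R_j=[r_j^-,r_j^+]$; a scenario is $r=(r_1,\dots,r_n)\in R=R_1\times\dots\times R_n$. For $j\in J$, $\bar r^j$ is the scenario in which job $j$ has release date $r_j^+$ and every other job $t$ has release date $r_t^-$. A schedule is a binary array $x=[x_{i,k,j}]$, $i\in M$, $k,j\in\{1,\dots,n\}$, where $x_{i,k,j}=1$ means job $j$ is the $k$th job on machine $i$, such that: $\sum_{i}\sum_{k}x_{i,k,j}=1$ for all $j$; $\sum_j x_{i,k,j}\le 1$ for all $i,k$; and the occupied positions on each machine are consecutive starting from the first ($\sum_j x_{i,k+1,j}\le\sum_{j}x_{i,k,j}$ for all $i$ and $1\le k\le n-1$). Completion times: $C_{i,0}(x,r)=0$, $C_{i,k}(x,r)=\sum_{j=1}^n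 x_{i,k,j}\big(p_{i,j}+\max\{C_{i,k-1}(x,r),r_j\}\big)$. With $n_i=\sum_{k}\sum_{j}x_{i,k,j}$, the makespan is $C_{\max}(x,r)=\max_{i\in M}C_{i,n_i}(x,r)$. Let $C_{\max}(x_r^* )=\min_{x'}C_{\max}(x',r)$ over all schedules $x'$. The regret is $Q(x,r)=C_{\max}(x,r)-C_{\max}(x_r^* )$ and the worst-case regret is $Z(x)=\max_{r\in R}Q(x,r)$. The minimax regret problem is to minimize $Z(x)$ over all schedules $x$. Partial\_Makespan (PM) algorithm: start with the empty schedule and $J(1)=J$. In iteration $u=1,\dots,n$: (a) for each $j\in J(u)$ let $U_j(\bar r^j;J(u))=\{t\in J(u)\setminus\{j\}: r_t^-<r_j^+\}$; select a job $v\in J(u)$ minimizing $|U_j(\bar r^j;J(u))|$ over $j\in J(u)$; if there are several minimizers, choose among them one with the smallest total averaged processing time $\sum_{l\in U_j(\bar r^j;J(u))}avg_l$, where $avg_l=m^{-1}\sum_{i=1}^m p_{i,l}$, remaining ties being broken arbitrarily. (b) Append $v$ at the first free position (after all jobs already assigned) of a machine $i'$ for which the resulting completion time of $v$ under scenario $\bar r^v$ is smallest among all machines (jobs already assigned keep their machines and positions; ties broken arbitrarily). Set $J(u+1)=J(u)\setminus\{v\}$. The schedule obtained after $n$ iterations is $x_{\mathrm{PM}}$. *)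

theory Defs
  imports Complex_Main "HOL-Library.FuncSet"
begin

text \<open>
  Jobs are \<open>{1..n}\<close>, machines are \<open>{1..m}\<close> and positions are \<open>{1..n}\<close>.  The parameter \<open>p i j\<close> is
  the processing time of job \<open>j\<close> on machine \<open>i\<close>, and the release date of job \<open>j\<close> lies in
  \<open>{rlo j..rhi j}\<close>.
\<close>

type_synonym schedule = "nat \<Rightarrow> nat \<Rightarrow> nat \<Rightarrow> nat"

definition scenarios :: "nat \<Rightarrow> (nat \<Rightarrow> real) \<Rightarrow> (nat \<Rightarrow> real) \<Rightarrow> (nat \<Rightarrow> real) set" where
  "scenarios n rlo rhi = (\<Pi>\<^sub>E j\<in>{1..n}. {rlo j..rhi j})"

definition extreme_scenario ::
  "nat \<Rightarrow> (nat \<Rightarrow> real) \<Rightarrow> (nat \<Rightarrow> real) \<Rightarrow> nat \<Rightarrow> nat \<Rightarrow> real" where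
  "extreme_scenario n rlo rhi j = (\<lambda>t\<in>{1..n}. if t = j then rhi t else rlo t)"

text \<open>
  An array indexed by \<open>{1..m} \<times> {1..n} \<times> {1..n}\<close> is a total function that vanishes outside the
  index ranges.  This makes the representation unique, so there are only finitely many schedules.
\<close>

definition schedules :: "nat \<Rightarrow> nat \<Rightarrow> schedule set" where
  "schedules n m = {x.
     (\<forall>i k j. x i k j \<in> {0, 1}) \<and>
     (\<forall>i k j. \<not> (i \<in> {1..m} \<and> k \<in> {1..n} \<and> j \<in> {1..n}) \<longrightarrow> x i k j = 0) \<and>
     (\<forall>j\<in>{1..n}. (\<Sum>i=1..m. \<Sum>k=1..n. x i k j) = 1) \<and>
     (\<forall>i\<in>{1..m}. \<forall>k\<in>{1..n}. (\<Sum>j=1..n. x i k j) \<le> 1) \<and>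
     (\<forall>i\<in>{1..m}. \<forall>k\<in>{1..<n}. (\<Sum>j=1..n. x i (k + 1) j) \<le> (\<Sum>j=1..n. x i k j))}"

primrec completion ::
  "nat \<Rightarrow> (nat \<Rightarrow> nat \<Rightarrow> real) \<Rightarrow> schedule \<Rightarrow> (nat \<Rightarrow> real) \<Rightarrow> nat \<Rightarrow> nat \<Rightarrow> real" where
  "completion n p x r i 0 = 0"
| "completion n p x r i (Suc k) =
     (\<Sum>j=1..n. real (x i (Suc k) j) * (p i j + max (completion n p x r i k) (r j)))"

definition njobs :: "nat \<Rightarrow> schedule \<Rightarrow> nat \<Rightarrow> nat" where
  "njobs n x i = (\<Sum>k=1..n. \<Sum>j=1..n. x i k j)"

definition makespan ::
  "nat \<Rightarrow> nat \<Rightarrow> (nat \<Rightarrow> nat \<Rightarrow> real) \<Rightarrow> schedule \<Rightarrow> (nat \<Rightarrow> real) \<Rightarrow> real" where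
  "makespan n m p x r = Max ((\<lambda>i. completion n p x r i (njobs n x i)) ` {1..m})"

definition opt_makespan :: "nat \<Rightarrow> nat \<Rightarrow> (nat \<Rightarrow> nat \<Rightarrow> real) \<Rightarrow> (nat \<Rightarrow> real) \<Rightarrow> real" where
  "opt_makespan n m p r = Min ((\<lambda>x. makespan n m p x r) ` schedules n m)"

definition regret ::
  "nat \<Rightarrow> nat \<Rightarrow> (nat \<Rightarrow> nat \<Rightarrow> real) \<Rightarrow> schedule \<Rightarrow> (nat \<Rightarrow> real) \<Rightarrow> real" where
  "regret n m p x r = makespan n m p x r - opt_makespan n m p r"

text \<open>
  The scenario set is infinite, so its maximum is written as a supremum; the regret is continuous
  in the scenario and the scenario set is compact, so the supremum is attained.
\<close>

definition worst_regret ::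
  "nat \<Rightarrow> nat \<Rightarrow> (nat \<Rightarrow> nat \<Rightarrow> real) \<Rightarrow> (nat \<Rightarrow> real) \<Rightarrow> (nat \<Rightarrow> real) \<Rightarrow> schedule \<Rightarrow> real" where
  "worst_regret n m p rlo rhi x = (SUP r\<in>scenarios n rlo rhi. regret n m p x r)"

definition U_set :: "(nat \<Rightarrow> real) \<Rightarrow> (nat \<Rightarrow> real) \<Rightarrow> nat set \<Rightarrow> nat \<Rightarrow> nat set" where
  "U_set rlo rhi A j = {t \<in> A - {j}. rlo t < rhi j}"

definition avg_time :: "nat \<Rightarrow> (nat \<Rightarrow> nat \<Rightarrow> real) \<Rightarrow> nat \<Rightarrow> real" where
  "avg_time m p l = (\<Sum>i=1..m. p i l) / real m"

definition pm_selects ::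
  "nat \<Rightarrow> (nat \<Rightarrow> nat \<Rightarrow> real) \<Rightarrow> (nat \<Rightarrow> real) \<Rightarrow> (nat \<Rightarrow> real) \<Rightarrow> nat set \<Rightarrow> nat \<Rightarrow> bool" where
  "pm_selects m p rlo rhi A v \<longleftrightarrow>
     v \<in> A \<and>
     (\<forall>j\<in>A. card (U_set rlo rhi A v) \<le> card (U_set rlo rhi A j)) \<and>
     (\<forall>j\<in>A. card (U_set rlo rhi A j) = card (U_set rlo rhi A v) \<longrightarrow>
        (\<Sum>l\<in>U_set rlo rhi A v. avg_time m p l) \<le> (\<Sum>l\<in>U_set rlo rhi A j. avg_time m p l))"

text \<open>
  Occupied positions are consecutive from 1, so the first free position on machine \<open>i\<close> is
  \<open>njobs n x i + 1\<close>.
\<close>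

definition append_job :: "nat \<Rightarrow> schedule \<Rightarrow> nat \<Rightarrow> nat \<Rightarrow> schedule" where
  "append_job n x i v = (\<lambda>i' k j. if i' = i \<and> k = njobs n x i + 1 \<and> j = v then 1 else x i' k j)"

definition append_completion ::
  "nat \<Rightarrow> (nat \<Rightarrow> nat \<Rightarrow> real) \<Rightarrow> schedule \<Rightarrow> (nat \<Rightarrow> real) \<Rightarrow> nat \<Rightarrow> nat \<Rightarrow> real" where
  "append_completion n p x r v i = completion n p (append_job n x i v) r i (njobs n x i + 1)"

text \<open>
  \<open>pm_state n m p rlo rhi u x A\<close>: after \<open>u\<close> iterations the algorithm can have built the partial
  schedule \<open>x\<close>, with the jobs in \<open>A\<close> still unassigned.  It is a relation because ties are broken
  arbitrarily.
\<close>

inductive pm_state ::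
  "nat \<Rightarrow> nat \<Rightarrow> (nat \<Rightarrow> nat \<Rightarrow> real) \<Rightarrow> (nat \<Rightarrow> real) \<Rightarrow> (nat \<Rightarrow> real) \<Rightarrow>
   nat \<Rightarrow> schedule \<Rightarrow> nat set \<Rightarrow> bool"
  for n m p rlo rhi where
  init: "pm_state n m p rlo rhi 0 (\<lambda>i k j. 0) {1..n}"
| step: "pm_state n m p rlo rhi (Suc u) (append_job n x i v) (A - {v})"
  if "pm_state n m p rlo rhi u x A"
    and "pm_selects m p rlo rhi A v"
    and "i \<in> {1..m}"
    and "\<forall>i'\<in>{1..m}. append_completion n p x (extreme_scenario n rlo rhi v) v i
                    \<le> append_completion n p x (extreme_scenario n rlo rhi v) v i'"

definition pm_output ::
  "nat \<Rightarrow> nat \<Rightarrow> (nat \<Rightarrow> nat \<Rightarrow> real) \<Rightarrow> (nat \<Rightarrow> real) \<Rightarrow> (nat \<Rightarrow> real) \<Rightarrow> schedule \<Rightarrow> bool" where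
  "pm_output n m p rlo rhi x \<longleftrightarrow> (\<exists>A. pm_state n m p rlo rhi n x A)"

lemma pm_selects_exists:
  assumes "finite A" "A \<noteq> {}"
  shows "\<exists>v. pm_selects m p rlo rhi A v"
proof -
  define c where "c j = card (U_set rlo rhi A j)" for j
  define s where "s j = (\<Sum>l\<in>U_set rlo rhi A j. avg_time m p l)" for j
  define B where "B = {j \<in> A. c j = Min (c ` A)}"
  have "Min (c ` A) \<in> c ` A"
    using assms by simp
  then obtain w where "w \<in> A" "c w = Min (c ` A)"
    by force
  then have B: "finite B" "B \<noteq> {}"
    using assms by (auto simp: B_def)
  then have "Min (s ` B) \<in> s ` B"
    by simp
  then obtain v where v: "v \<in> B" "s v = Min (s ` B)"
    by force
  have "\<forall>j\<in>A. c v \<le> c j"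
    using v(1) assms by (auto simp: B_def)
  moreover have "\<forall>j\<in>A. c j = c v \<longrightarrow> s v \<le> s j"
    using v B by (auto simp: B_def)
  ultimately show ?thesis
    using v(1) by (auto simp: pm_selects_def c_def s_def B_def)
qed

lemma pm_state_exists:
  assumes "m \<ge> 1" "u \<le> n"
  shows "\<exists>x A. pm_state n m p rlo rhi u x A \<and> finite A \<and> card A = n - u"
  using assms(2)
proof (induction u)
  case 0
  show ?case
    using pm_state.init by fastforce
next
  case (Suc u)
  then obtain x A where xA: "pm_state n m p rlo rhi u x A" "finite A" "card A = n - u"
    by auto
  then have "A \<noteq> {}"
    using Suc.prems by auto
  then obtain v where v: "pm_selects m p rlo rhi A v"
    using pm_selects_exists xA(2) by blast
  define f where "f = append_completion n p x (extreme_scenario n rlo rhi v) v"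
  have "Min (f ` {1..m}) \<in> f ` {1..m}"
    using assms(1) by (intro Min_in) auto
  then obtain i where i: "i \<in> {1..m}" "f i = Min (f ` {1..m})"
    by force
  have "\<forall>i'\<in>{1..m}. f i \<le> f i'"
    using i(2) by simp
  then have "pm_state n m p rlo rhi (Suc u) (append_job n x i v) (A - {v})"
    using pm_state.step[OF xA(1) v i(1)] by (simp add: f_def)
  moreover have "card (A - {v}) = n - Suc u"
    using v xA by (simp add: pm_selects_def)
  ultimately show ?case
    using xA(2) by blast
qed

lemma pm_output_exists: "m \<ge> 1 \<Longrightarrow> \<exists>x. pm_output n m p rlo rhi x"
  using pm_state_exists[of m n n] unfolding pm_output_def by blast

end

theory Submission
  imports Defs
begin

text \<open>
  Let \<open>L\<close> be the job of the hypothesis.  No other job \<open>t\<close> has \<open>L\<close> in its set \<open>U_t\<close>, while \<open>U_L\<close>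
  contains every other remaining job, so the algorithm selects \<open>L\<close> last.  By then every machine is
  free before the lower end of the release interval of \<open>L\<close>, whatever the scenario, so \<open>L\<close> goes to
  a machine on which it is fastest and the makespan is \<open>r L + min_i p i L\<close> in every scenario \<open>r\<close>.
  No schedule can do better, so the regret of the output is identically \<open>0\<close>.
\<close>

section \<open>Partial schedules\<close>

text \<open>The state of the algorithm once exactly the jobs of \<open>B\<close> are placed.
  Consecutiveness of occupied positions is encoded through \<open>njobs\<close>, so that the
  position used by \<open>append_job\<close> is immediately seen to be free.\<close>

definition partial_schedule :: "nat \<Rightarrow> nat \<Rightarrow> schedule \<Rightarrow> nat set \<Rightarrow> bool" where
  "partial_schedule n m x B \<longleftrightarrow>
     (\<forall>i k j. x i k j \<in> {0, 1}) \<and>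
     (\<forall>i k j. \<not> (i \<in> {1..m} \<and> k \<in> {1..n} \<and> j \<in> B) \<longrightarrow> x i k j = 0) \<and>
     (\<forall>j\<in>B. (\<Sum>i=1..m. \<Sum>k=1..n. x i k j) = 1) \<and>
     (\<forall>i\<in>{1..m}. \<forall>k\<in>{1..n}. (\<Sum>j=1..n. x i k j) = (if k \<le> njobs n x i then 1 else 0))"

lemma partial_schedule_entry_eq_1:
  assumes "partial_schedule n m x B" "x i k j \<noteq> 0"
  shows "x i k j = 1"
proof -
  have "x i k j \<in> {0, 1}"
    using assms(1) unfolding partial_schedule_def by blast
  then show ?thesis using assms(2) by blast
qed

text \<open>A nonincreasing 0/1 sequence is a block of ones followed by zeros, and its sum is the
  length of the block. If \<open>s k = 0\<close>, only the first \<open>k - 1\<close> terms can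
  contribute; otherwise the first \<open>k\<close> terms are all positive.\<close>

lemma antimono_binary_eq_prefix_indicator:
  fixes s :: "nat \<Rightarrow> nat"
  assumes "\<And>k. k \<in> {1..n} \<Longrightarrow> s k \<le> 1"
    and "\<And>k. k \<in> {1..<n} \<Longrightarrow> s (k + 1) \<le> s k"
    and "k \<in> {1..n}"
  shows "s k = (if k \<le> (\<Sum>k=1..n. s k) then 1 else 0)"
proof -
  have anti: "s b \<le> s a" if "a \<le> b" "a \<ge> 1" "b \<le> n" for a b
    using that
  proof (induction b rule: dec_induct)
    case (step b)
    then show ?case using assms(2)[of b] by auto
  qed simp
  show ?thesis
  proof (cases "s k = 0")
    case True
    have "(\<Sum>k=1..n. s k) = (\<Sum>k\<in>{1..<k}. s k)"
      using True anti[of k] assms(3) by (intro sum.mono_neutral_right) auto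
    also have "\<dots> \<le> (\<Sum>k\<in>{1..<k}. 1)"
      using assms(1,3) by (intro sum_mono) auto
    also have "\<dots> < k"
      using assms(3) by auto
    finally show ?thesis
      using True by simp
  next
    case False
    have "k = (\<Sum>k\<in>{1..k}. 1)"
      by simp
    also have "\<dots> \<le> (\<Sum>k\<in>{1..k}. s k)"
      using anti[of _ k] assms(3) False by (intro sum_mono) fastforce
    also have "\<dots> \<le> (\<Sum>k=1..n. s k)"
      using assms(3) by (intro sum_mono2) auto
    finally show ?thesis
      using False assms(1)[OF assms(3)] by simp
  qed
qed

lemma schedules_iff_partial_schedule:
  "x \<in> schedules n m \<longleftrightarrow> partial_schedule n m x {1..n}"
proof
  assume x: "x \<in> schedules n m"
  have "(\<Sum>j=1..n. x i k j) = (if k \<le> njobs n x i then 1 else 0)"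
    if "i \<in> {1..m}" "k \<in> {1..n}" for i k
    unfolding njobs_def
    by (rule antimono_binary_eq_prefix_indicator) (use x that in \<open>auto simp: schedules_def\<close>)
  then show "partial_schedule n m x {1..n}"
    using x unfolding schedules_def partial_schedule_def by blast
next
  assume "partial_schedule n m x {1..n}"
  then show "x \<in> schedules n m"
    unfolding partial_schedule_def schedules_def by auto
qed

text \<open>A binary array is determined by its support, here a subset of a finite box. Finiteness
  is what gives the \<open>Min\<close> in \<open>opt_makespan\<close> and in the theorem its
  intended meaning.\<close>

lemma finite_schedules: "finite (schedules n m)"
proof -
  define supp :: "schedule \<Rightarrow> (nat \<times> nat \<times> nat) set" where "supp x = {(i, k, j). x i k j = (1::nat)}" for x
  have "inj_on supp (schedules n m)"
  proof (rule inj_onI)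
    fix x y
    assume x: "x \<in> schedules n m" and y: "y \<in> schedules n m" and eq: "supp x = supp y"
    have "x i k j = 1 \<longleftrightarrow> y i k j = 1" for i k j
      using eq unfolding supp_def by (auto simp: set_eq_iff)
    moreover have "x i k j \<in> {0, 1}" "y i k j \<in> {0, 1}" for i k j
      using x y by (auto simp: schedules_def)
    ultimately have "x i k j = y i k j" for i k j
      by (metis insertE singletonD)
    then show "x = y" by blast
  qed
  moreover have "supp ` schedules n m \<subseteq> Pow ({1..m} \<times> {1..n} \<times> {1..n})"
  proof
    fix S assume "S \<in> supp ` schedules n m"
    then obtain x where x: "x \<in> schedules n m" "S = supp x" by blast
    have "i \<in> {1..m} \<and> k \<in> {1..n} \<and> j \<in> {1..n}" if "x i k j = 1" for i k j
    proof (rule ccontr)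
      assume "\<not> ?thesis"
      then have "x i k j = 0"
        using x(1) unfolding schedules_def by blast
      then show False using that by simp
    qed
    then show "S \<in> Pow ({1..m} \<times> {1..n} \<times> {1..n})"
      using x(2) by (auto simp: supp_def)
  qed
  ultimately show ?thesis
    using finite_imageD finite_subset by (metis finite_Pow_iff finite_SigmaI finite_atLeastAtMost)
qed

text \<open>Double counting of the occupied entries: once by machine, once by job, where each job of
  \<open>B\<close> contributes one.\<close>

lemma sum_njobs:
  assumes "partial_schedule n m x B" "B \<subseteq> {1..n}"
  shows "(\<Sum>i=1..m. njobs n x i) = card B"
proof -
  have "(\<Sum>i=1..m. njobs n x i) = (\<Sum>i=1..m. \<Sum>j=1..n. \<Sum>k=1..n. x i k j)"
    unfolding njobs_def by (intro sum.cong refl sum.swap)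
  also have "\<dots> = (\<Sum>j=1..n. \<Sum>i=1..m. \<Sum>k=1..n. x i k j)"
    by (rule sum.swap)
  also have "\<dots> = (\<Sum>j\<in>B. \<Sum>i=1..m. \<Sum>k=1..n. x i k j)"
    using assms by (intro sum.mono_neutral_right) (auto simp: partial_schedule_def)
  also have "\<dots> = (\<Sum>j\<in>B. 1)"
    using assms by (intro sum.cong) (auto simp: partial_schedule_def)
  finally show ?thesis by simp
qed

lemma njobs_le_card:
  assumes "partial_schedule n m x B" "B \<subseteq> {1..n}" "i \<in> {1..m}"
  shows "njobs n x i \<le> card B"
  using sum_njobs[OF assms(1,2)] member_le_sum[of i "{1..m}" "njobs n x"] assms(3) by simp

lemma partial_schedule_empty: "partial_schedule n m (\<lambda>i k j. 0) {}"
  by (auto simp: partial_schedule_def njobs_def)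

section \<open>Appending a job\<close>

text \<open>Since \<open>v\<close> is not yet placed, the overwritten entry was 0, so overwriting is
  adding an indicator. All sums over the new array then split by linearity.\<close>

lemma append_job_eq_add:
  assumes "partial_schedule n m x B" "v \<notin> B"
  shows "append_job n x i v i' k j = x i' k j + (if i' = i \<and> k = njobs n x i + 1 \<and> j = v then 1 else 0)"
  using assms by (auto simp: append_job_def partial_schedule_def)

lemma sum_append_job:
  assumes "partial_schedule n m x B" "v \<notin> B" "v \<in> {1..n}"
  shows "(\<Sum>j=1..n. append_job n x i v i' k j) =
           (\<Sum>j=1..n. x i' k j) + (if i' = i \<and> k = njobs n x i + 1 then 1 else 0)"
proof -
  \<comment> \<open>The conjunction is nested so that the sum has the shape of
    \<open>sum.delta\<close>; the same rearrangement recurs for the other index sums.\<close>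
  have "(\<Sum>j=1..n. if i' = i \<and> k = njobs n x i + 1 \<and> j = v then 1 else 0 :: nat) =
        (\<Sum>j=1..n. if j = v then (if i' = i \<and> k = njobs n x i + 1 then 1 else 0) else 0)"
    by (intro sum.cong) auto
  also have "\<dots> = (if i' = i \<and> k = njobs n x i + 1 then 1 else 0)"
    using assms(3) by (subst sum.delta) auto
  finally show ?thesis
    by (simp only: append_job_eq_add[OF assms(1,2)] sum.distrib)
qed

text \<open>The bound \<open>njobs n x i < n\<close> puts the new position inside the range
  \<open>{1..n}\<close> over which \<open>njobs\<close> counts.\<close>

lemma njobs_append_job:
  assumes "partial_schedule n m x B" "v \<notin> B" "v \<in> {1..n}" "njobs n x i < n"
  shows "njobs n (append_job n x i v) i' = njobs n x i' + (if i' = i then 1 else 0)"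
proof -
  have "(\<Sum>k=1..n. if i' = i \<and> k = njobs n x i + 1 then 1 else 0 :: nat) =
        (\<Sum>k=1..n. if k = njobs n x i + 1 then (if i' = i then 1 else 0) else 0)"
    by (intro sum.cong) auto
  also have "\<dots> = (if i' = i then 1 else 0)"
    using assms(4) by (subst sum.delta) auto
  finally show ?thesis
    unfolding njobs_def[of n "append_job n x i v"] sum_append_job[OF assms(1-3)] sum.distrib
    by (simp add: njobs_def)
qed

lemma partial_schedule_append_job:
  assumes x: "partial_schedule n m x B" and v: "v \<notin> B" "v \<in> {1..n}"
    and i: "i \<in> {1..m}" "njobs n x i < n"
  shows "partial_schedule n m (append_job n x i v) (insert v B)"
  unfolding partial_schedule_def
proof (intro conjI allI ballI impI)
  fix i' k j
  show "append_job n x i v i' k j \<in> {0, 1}"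
    using x by (auto simp: append_job_def partial_schedule_def)
  assume "\<not> (i' \<in> {1..m} \<and> k \<in> {1..n} \<and> j \<in> insert v B)"
  then show "append_job n x i v i' k j = 0"
    using x i by (auto simp: append_job_def partial_schedule_def)
next
  fix j assume j: "j \<in> insert v B"
  have "(\<Sum>i'=1..m. \<Sum>k=1..n. if i' = i \<and> k = njobs n x i + 1 \<and> j = v then 1 else 0 :: nat) =
        (\<Sum>i'=1..m. if i' = i then (if j = v then 1 else 0) else 0)"
  proof (rule sum.cong[OF refl])
    fix i'
    have "(\<Sum>k=1..n. if i' = i \<and> k = njobs n x i + 1 \<and> j = v then 1 else 0 :: nat) =
          (\<Sum>k=1..n. if k = njobs n x i + 1 then (if i' = i \<and> j = v then 1 else 0) else 0)"
      by (intro sum.cong) auto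
    also have "\<dots> = (if i' = i \<and> j = v then 1 else 0)"
      using i(2) by (subst sum.delta) auto
    finally show "(\<Sum>k=1..n. if i' = i \<and> k = njobs n x i + 1 \<and> j = v then 1 else 0 :: nat) =
        (if i' = i then (if j = v then 1 else 0) else 0)"
      by simp
  qed
  also have "\<dots> = (if j = v then 1 else 0)"
    using i by (simp add: sum.delta)
  finally have "(\<Sum>i'=1..m. \<Sum>k=1..n. append_job n x i v i' k j) =
        (\<Sum>i'=1..m. \<Sum>k=1..n. x i' k j) + (if j = v then 1 else 0)"
    by (simp only: append_job_eq_add[OF x v(1)] sum.distrib)
  moreover have "(\<Sum>i'=1..m. \<Sum>k=1..n. x i' k j) = (if j = v then 0 else 1)"
    using x v j by (auto simp: partial_schedule_def)
  ultimately show "(\<Sum>i'=1..m. \<Sum>k=1..n. append_job n x i v i' k j) = 1"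
    by simp
next
  fix i' k assume "i' \<in> {1..m}" "k \<in> {1..n}"
  then have "(\<Sum>j=1..n. x i' k j) = (if k \<le> njobs n x i' then 1 else 0)"
    using x by (simp add: partial_schedule_def)
  then show "(\<Sum>j=1..n. append_job n x i v i' k j) =
      (if k \<le> njobs n (append_job n x i v) i' then 1 else 0)"
    unfolding sum_append_job[OF x v] njobs_append_job[OF x v i(2)] by auto
qed

section \<open>Completion times\<close>

lemma completion_cong:
  assumes "\<And>k' j. k' \<le> k \<Longrightarrow> x i k' j = y i k' j"
  shows "completion n p x r i k = completion n p y r i k"
  using assms by (induction k) auto

text \<open>A position holds at most one job, so all other entries vanish and the defining sum
  collapses to the usual recursion for \<open>j\<close>.\<close>

lemma completion_Suc_eq:
  assumes "x i (Suc k) j = 1" "j \<in> {1..n}" "(\<Sum>j=1..n. x i (Suc k) j) \<le> 1"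
  shows "completion n p x r i (Suc k) = p i j + max (completion n p x r i k) (r j)"
proof -
  have "(\<Sum>j=1..n. x i (Suc k) j) = x i (Suc k) j + (\<Sum>j\<in>{1..n}-{j}. x i (Suc k) j)"
    using assms(2) by (intro sum.remove) auto
  then have "(\<Sum>j\<in>{1..n}-{j}. x i (Suc k) j) = 0"
    using assms by linarith
  then have z: "\<And>t. t \<in> {1..n} - {j} \<Longrightarrow> x i (Suc k) t = 0"
    by (subst (asm) sum_eq_0_iff) auto
  have "completion n p x r i (Suc k) =
      (\<Sum>t\<in>{j}. real (x i (Suc k) t) * (p i t + max (completion n p x r i k) (r t)))"
    unfolding completion.simps using assms(2) z by (intro sum.mono_neutral_right) auto
  then show ?thesis using assms(1) by simp
qed

lemma completion_append_job_last:
  assumes x: "partial_schedule n m x B" and v: "v \<notin> B" "v \<in> {1..n}"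
    and i: "i \<in> {1..m}" "njobs n x i < n"
  shows "completion n p (append_job n x i v) r i (Suc (njobs n x i)) =
           p i v + max (completion n p x r i (njobs n x i)) (r v)"
proof -
  have "(\<Sum>j=1..n. append_job n x i v i (Suc (njobs n x i)) j) \<le> 1"
    using partial_schedule_append_job[OF assms] i by (auto simp: partial_schedule_def)
  then have "completion n p (append_job n x i v) r i (Suc (njobs n x i)) =
      p i v + max (completion n p (append_job n x i v) r i (njobs n x i)) (r v)"
    using v by (intro completion_Suc_eq) (auto simp: append_job_def)
  also have "completion n p (append_job n x i v) r i (njobs n x i) = completion n p x r i (njobs n x i)"
    by (rule completion_cong) (auto simp: append_job_def)
  finally show ?thesis .
qed

lemma completion_mono_scenario:
  assumes "\<And>j. j \<in> {1..n} \<Longrightarrow> r j \<le> r' j"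
  shows "completion n p x r i k \<le> completion n p x r' i k"
proof (induction k)
  case (Suc k)
  then show ?case
    unfolding completion.simps using assms
    by (intro sum_mono mult_left_mono add_left_mono max.mono) auto
qed simp

text \<open>Each occupied position adds a nonnegative processing time. The restriction to
  \<open>njobs n x i\<close> matters: at an empty position the defining sum is empty of jobs and
  \<open>completion\<close> falls back to 0.\<close>

lemma completion_mono_position:
  assumes x: "partial_schedule n m x B" and i: "i \<in> {1..m}"
    and p: "\<And>j. j \<in> {1..n} \<Longrightarrow> p i j \<ge> 0"
    and k: "k \<le> k'" "k' \<le> njobs n x i" "k' \<le> n"
  shows "completion n p x r i k \<le> completion n p x r i k'"
  using k
proof (induction k' rule: dec_induct)
  case (step k')
  have s: "(\<Sum>j=1..n. x i (Suc k') j) = 1"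
    using x i step.prems by (simp add: partial_schedule_def)
  then obtain j where j: "j \<in> {1..n}" "x i (Suc k') j \<noteq> 0"
    by (metis (no_types, lifting) sum.neutral zero_neq_one)
  then have "x i (Suc k') j = 1"
    using x by (intro partial_schedule_entry_eq_1) auto
  then have "completion n p x r i (Suc k') = p i j + max (completion n p x r i k') (r j)"
    using j s by (intro completion_Suc_eq) auto
  then show ?case
    using step p[OF j(1)] by auto
qed simp

text \<open>From time \<open>R\<close> on every job of \<open>B\<close> is available, so the machine
  never idles after \<open>R\<close> and only its load can be added. \<open>R \<ge> 0\<close> covers
  the start at time 0 and the value 0 at empty positions.\<close>

lemma completion_le_release_plus_load:
  assumes x: "partial_schedule n m x B" and i: "i \<in> {1..m}"
    and B: "B \<subseteq> {1..n}"
    and r: "\<And>j. j \<in> B \<Longrightarrow> r j \<le> R" "R \<ge> 0"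
    and p: "\<And>j. j \<in> {1..n} \<Longrightarrow> p i j \<ge> 0"
    and k: "k \<le> n"
  shows "completion n p x r i k \<le> R + (\<Sum>l=1..k. \<Sum>j=1..n. real (x i l j) * p i j)"
  using k
proof (induction k)
  case (Suc k)
  define W where "W = R + (\<Sum>l=1..k. \<Sum>j=1..n. real (x i l j) * p i j)"
  have W: "W \<ge> R" "W \<ge> 0"
    unfolding W_def using p r(2) by (auto intro!: sum_nonneg add_nonneg_nonneg)
  have "(\<Sum>j=1..n. x i (Suc k) j) \<le> 1"
    using x i Suc.prems by (auto simp: partial_schedule_def)
  then have s: "(\<Sum>j=1..n. real (x i (Suc k) j)) \<le> 1"
    unfolding of_nat_sum[symmetric] by linarith
  have "real (x i (Suc k) j) * (p i j + max (completion n p x r i k) (r j)) \<le>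
      real (x i (Suc k) j) * p i j + real (x i (Suc k) j) * W" for j
  proof (cases "j \<in> B")
    case True
    then have "max (completion n p x r i k) (r j) \<le> W"
      using Suc r(1)[OF True] W by (auto simp: W_def)
    then show ?thesis
      unfolding distrib_left[symmetric] by (intro mult_left_mono) auto
  next
    \<comment> \<open>The release date of a job outside \<open>B\<close> may exceed
      \<open>R\<close>, but its coefficient is 0.\<close>
    case False
    then have "x i (Suc k) j = 0"
      using x by (simp add: partial_schedule_def)
    then show ?thesis by simp
  qed
  then have "completion n p x r i (Suc k) \<le>
      (\<Sum>j=1..n. real (x i (Suc k) j) * p i j + real (x i (Suc k) j) * W)"
    unfolding completion.simps by (intro sum_mono) auto
  also have "\<dots> = (\<Sum>j=1..n. real (x i (Suc k) j) * p i j) + (\<Sum>j=1..n. real (x i (Suc k) j)) * W"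
    by (simp only: sum.distrib sum_distrib_right)
  also have "\<dots> \<le> (\<Sum>j=1..n. real (x i (Suc k) j) * p i j) + W"
    using mult_right_mono[OF s W(2)] by simp
  finally show ?case
    by (simp add: W_def)
qed (use r(2) in simp)

text \<open>Each job of \<open>B\<close> occupies at most one position on machine \<open>i\<close>,
  and its time there is at most its largest time over all machines.\<close>

lemma load_le_sum_max_time:
  assumes x: "partial_schedule n m x B" and i: "i \<in> {1..m}"
    and B: "B \<subseteq> {1..n}"
    and p: "\<And>i j. i \<in> {1..m} \<Longrightarrow> j \<in> {1..n} \<Longrightarrow> p i j \<ge> 0"
    and k: "k \<le> n"
  shows "(\<Sum>l=1..k. \<Sum>j=1..n. real (x i l j) * p i j) \<le> (\<Sum>j\<in>B. Max ((\<lambda>i. p i j) ` {1..m}))"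
proof -
  have "(\<Sum>l=1..k. \<Sum>j=1..n. real (x i l j) * p i j) \<le> (\<Sum>l=1..n. \<Sum>j=1..n. real (x i l j) * p i j)"
    using k p[OF i] by (intro sum_mono2 sum_nonneg) auto
  also have "\<dots> = (\<Sum>j=1..n. \<Sum>l=1..n. real (x i l j) * p i j)"
    by (rule sum.swap)
  also have "\<dots> = (\<Sum>j=1..n. real (\<Sum>l=1..n. x i l j) * p i j)"
    by (simp add: sum_distrib_right)
  also have "\<dots> = (\<Sum>j\<in>B. real (\<Sum>l=1..n. x i l j) * p i j)"
    using x B by (intro sum.mono_neutral_right) (auto simp: partial_schedule_def)
  also have "\<dots> \<le> (\<Sum>j\<in>B. Max ((\<lambda>i. p i j) ` {1..m}))"
  proof (rule sum_mono)
    fix j assume j: "j \<in> B"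
    have "(\<Sum>l=1..n. x i l j) \<le> (\<Sum>i=1..m. \<Sum>l=1..n. x i l j)"
      using i by (intro member_le_sum) auto
    then have "(\<Sum>l=1..n. x i l j) \<le> 1"
      using x j by (simp add: partial_schedule_def)
    then have "real (\<Sum>l=1..n. x i l j) \<le> 1"
      by linarith
    then have "real (\<Sum>l=1..n. x i l j) * p i j \<le> p i j"
      using p[OF i, of j] j B by (intro mult_left_le_one_le) (auto intro: sum_nonneg)
    also have "\<dots> \<le> Max ((\<lambda>i. p i j) ` {1..m})"
      using i by (intro Max_ge) auto
    finally show "real (\<Sum>l=1..n. x i l j) * p i j \<le> Max ((\<lambda>i. p i j) ` {1..m})" .
  qed
  finally show ?thesis .
qed

section \<open>Bounds on the makespan\<close>

lemma makespan_ge_completion: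
  "i \<in> {1..m} \<Longrightarrow> completion n p x r i (njobs n x i) \<le> makespan n m p x r"
  unfolding makespan_def by (intro Max_ge) auto

lemma makespan_mono_scenario:
  assumes "\<And>j. j \<in> {1..n} \<Longrightarrow> r j \<le> r' j" "m \<ge> 1"
  shows "makespan n m p x r \<le> makespan n m p x r'"
proof -
  have "completion n p x r i (njobs n x i) \<le> makespan n m p x r'" if "i \<in> {1..m}" for i
    using completion_mono_scenario[OF assms(1)] makespan_ge_completion[OF that] by (rule order_trans)
  then show ?thesis
    unfolding makespan_def[of n m p x r] using assms(2) by (subst Max_le_iff) auto
qed

text \<open>Wherever \<open>j\<close> is placed, it starts no earlier than \<open>r j\<close> and
  runs for at least \<open>q\<close>; the jobs after it on its machine only increase the completion
  time.\<close>

lemma makespan_ge_release_plus_min_time: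
  assumes x: "x \<in> schedules n m" and j: "j \<in> {1..n}"
    and p: "\<And>i j. i \<in> {1..m} \<Longrightarrow> j \<in> {1..n} \<Longrightarrow> p i j \<ge> 0"
    and q: "\<And>i. i \<in> {1..m} \<Longrightarrow> q \<le> p i j"
  shows "r j + q \<le> makespan n m p x r"
proof -
  have ps: "partial_schedule n m x {1..n}"
    using x by (simp add: schedules_iff_partial_schedule)
  have "(\<Sum>i=1..m. \<Sum>k=1..n. x i k j) = 1"
    using x j by (simp add: schedules_def)
  then obtain i where i: "i \<in> {1..m}" "(\<Sum>k=1..n. x i k j) \<noteq> 0"
    by (metis (no_types, lifting) sum.neutral zero_neq_one)
  then obtain k where k: "k \<in> {1..n}" "x i k j \<noteq> 0"
    by (metis (no_types, lifting) sum.neutral)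
  then have x1: "x i k j = 1"
    using ps by (intro partial_schedule_entry_eq_1) auto
  have "x i k j \<le> (\<Sum>j=1..n. x i k j)"
    using j by (intro member_le_sum) auto
  moreover have s: "(\<Sum>j=1..n. x i k j) = (if k \<le> njobs n x i then 1 else 0)"
    using ps i(1) k(1) by (simp add: partial_schedule_def)
  ultimately have kN: "k \<le> njobs n x i"
    using x1 by (auto split: if_splits)
  have "njobs n x i \<le> n"
    using njobs_le_card[OF ps _ i(1)] by simp
  then have mono: "completion n p x r i k \<le> completion n p x r i (njobs n x i)"
    using kN p i(1) by (intro completion_mono_position[OF ps i(1)]) auto
  obtain k' where k': "k = Suc k'"
    using k(1) by (cases k) auto
  have "completion n p x r i k = p i j + max (completion n p x r i k') (r j)"
    unfolding k' using x1 j s k' by (intro completion_Suc_eq) auto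
  then have "r j + q \<le> completion n p x r i k"
    using q[OF i(1)] by linarith
  then show ?thesis
    using mono makespan_ge_completion[OF i(1), of n p x r] by linarith
qed

section \<open>The late job is scheduled last\<close>

text \<open>For another remaining job \<open>t\<close>, the set \<open>U_t\<close> misses both
  \<open>t\<close> and \<open>L\<close>, whereas \<open>U_L\<close> misses only \<open>L\<close>.
  Hence \<open>L\<close> is never a minimizer of the cardinality while another job remains, and the
  tie-breaking rule is never reached for it.\<close>

lemma pm_selects_late_job_last:
  assumes late: "\<And>t. t \<in> A - {L} \<Longrightarrow> rhi t \<le> rlo L"
    and lt: "\<And>t. t \<in> A \<Longrightarrow> rlo t < rhi t"
    and A: "finite A" "L \<in> A" and sel: "pm_selects m p rlo rhi A L"
  shows "A = {L}"
proof (rule ccontr)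
  assume "A \<noteq> {L}"
  then obtain t where t: "t \<in> A" "t \<noteq> L" using A by blast
  have UL: "U_set rlo rhi A L = A - {L}"
  proof -
    have "rlo t < rhi L" if "t \<in> A - {L}" for t
      using late[OF that] lt[of t] lt[OF A(2)] that by simp
    then show ?thesis by (auto simp: U_set_def)
  qed
  have "U_set rlo rhi A t \<subseteq> A - {L} - {t}"
    unfolding U_set_def using late[of t] t by auto
  then have "card (U_set rlo rhi A t) \<le> card (A - {L} - {t})"
    using A by (intro card_mono) auto
  also have "\<dots> < card (A - {L})"
    using A t by (intro card_Diff1_less) auto
  finally show False
    using sel t(1) unfolding pm_selects_def UL by (meson leD)
qed

lemma pm_state_invariant:
  assumes "pm_state n m p rlo rhi u x A"
    and late: "\<And>t. t \<in> {1..n} - {L} \<Longrightarrow> rhi t \<le> rlo L"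
    and lt: "\<And>t. t \<in> {1..n} \<Longrightarrow> rlo t < rhi t"
    and L: "L \<in> {1..n}"
  shows "A \<subseteq> {1..n} \<and> card A + u = n \<and> (L \<in> A \<or> A = {}) \<and> partial_schedule n m x ({1..n} - A)"
  using assms(1)
proof induction
  case init
  show ?case
    using L partial_schedule_empty by auto
next
  case (step u x A v i)
  then have A: "A \<subseteq> {1..n}" and cA: "card A + u = n" and LA: "L \<in> A \<or> A = {}"
    and ps: "partial_schedule n m x ({1..n} - A)"
    by auto
  have fin: "finite A"
    using A finite_subset by blast
  have v: "v \<in> A"
    using step.hyps by (simp add: pm_selects_def)
  have cpos: "card A > 0"
    using v fin card_gt_0_iff by blast
  have "L \<in> A - {v} \<or> A - {v} = {}"
    using LA v pm_selects_late_job_last[of A L rhi rlo m p] step.hyps late lt A fin by blast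
  moreover have "card (A - {v}) + Suc u = n"
    using v cA fin cpos by simp
  \<comment> \<open>Only \<open>u < n\<close> jobs are placed so far, so every machine still has a
    free position.\<close>
  moreover have "card ({1..n} - A) = u"
    using A cA fin by (simp add: card_Diff_subset)
  then have "njobs n x i < n"
    using njobs_le_card[OF ps _ step.hyps(3)] cA cpos by simp
  then have "partial_schedule n m (append_job n x i v) (insert v ({1..n} - A))"
    using v A step.hyps(3) by (intro partial_schedule_append_job[OF ps]) auto
  moreover have "insert v ({1..n} - A) = {1..n} - (A - {v})"
    using v A by auto
  ultimately show ?case
    using A by auto
qed

section \<open>Makespan of the schedule built by the algorithm\<close>

text \<open>The number \<open>q\<close> is the processing time of \<open>L\<close> on the machine
  chosen in the last iteration, which turns out to be the smallest one. The bound \<open>R\<close>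
  stands for the largest upper release date among the other jobs.\<close>

lemma pm_output_makespan:
  assumes out: "pm_output n m p rlo rhi x" and n: "n \<ge> 1" and m: "m \<ge> 1"
    and L: "L \<in> {1..n}"
    and p: "\<And>i j. i \<in> {1..m} \<Longrightarrow> j \<in> {1..n} \<Longrightarrow> p i j \<ge> 0"
    and lt: "\<And>t. t \<in> {1..n} \<Longrightarrow> rlo t < rhi t"
    and R: "R \<ge> 0" "\<And>t. t \<in> {1..n} - {L} \<Longrightarrow> rhi t \<le> R"
    and late: "R + (\<Sum>k\<in>{1..n} - {L}. Max ((\<lambda>i. p i k) ` {1..m})) \<le> rlo L"
  obtains q where "x \<in> schedules n m" "\<And>i. i \<in> {1..m} \<Longrightarrow> q \<le> p i L"
    "\<And>r. r \<in> scenarios n rlo rhi \<Longrightarrow> makespan n m p x r \<le> r L + q"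
proof -
  have pmax: "Max ((\<lambda>i. p i k) ` {1..m}) \<ge> 0" if "k \<in> {1..n}" for k
    using p[of 1 k] that m by (subst Max_ge_iff) (auto intro!: bexI[of _ 1])
  have "(\<Sum>k\<in>{1..n} - {L}. Max ((\<lambda>i. p i k) ` {1..m})) \<ge> 0"
    using pmax by (intro sum_nonneg) auto
  then have late': "\<And>t. t \<in> {1..n} - {L} \<Longrightarrow> rhi t \<le> rlo L"
    using R(2) late by fastforce
  obtain B where B: "pm_state n m p rlo rhi n x B"
    using out by (auto simp: pm_output_def)
  have inv: "A \<subseteq> {1..n} \<and> card A + u = n \<and> (L \<in> A \<or> A = {}) \<and> partial_schedule n m y ({1..n} - A)"
    if "pm_state n m p rlo rhi u y A" for u y A
    using that late' lt L by (rule pm_state_invariant)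
  have "finite B"
    using inv[OF B] finite_subset by blast
  then have "B = {}"
    using inv[OF B] by auto
  then have sched: "x \<in> schedules n m"
    using inv[OF B] by (simp add: schedules_iff_partial_schedule)
  \<comment> \<open>As \<open>n \<ge> 1\<close>, the final state arises from a last iteration:
    \<open>y\<close> is the schedule before it, and the one remaining job must be
    \<open>L\<close>.\<close>
  from B obtain u y A v i where *: "x = append_job n y i v" "B = A - {v}" "n = Suc u"
      "pm_state n m p rlo rhi u y A" "v \<in> A" "i \<in> {1..m}"
      "\<forall>i'\<in>{1..m}. append_completion n p y (extreme_scenario n rlo rhi v) v i
                      \<le> append_completion n p y (extreme_scenario n rlo rhi v) v i'"
    using n by cases (auto simp: pm_selects_def)
  have "L \<in> A"
    using inv[OF *(4)] *(5) by auto
  then have v: "v = L" and A: "A = {L}"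
    using \<open>B = {}\<close> *(2,5) by auto
  let ?C = "{1..n} - {L}"
  have ps: "partial_schedule n m y ?C"
    using inv[OF *(4)] A by simp
  have card: "card ?C = u"
    using L *(3) by simp
  have N: "njobs n y i' < n" if "i' \<in> {1..m}" for i'
    using njobs_le_card[OF ps _ that] card *(3) by auto
  \<comment> \<open>No bound on \<open>r L\<close> is imposed, because \<open>y\<close> does not
    contain \<open>L\<close>. This lets the claim serve both the extreme scenario of
    \<open>L\<close> and arbitrary scenarios.\<close>
  have early: "completion n p y r i' k \<le> rlo L"
    if i': "i' \<in> {1..m}" and "k \<le> n" and r: "\<And>t. t \<in> ?C \<Longrightarrow> r t \<le> rhi t" for r i' k
  proof -
    have "completion n p y r i' k \<le> R + (\<Sum>l=1..k. \<Sum>j=1..n. real (y i' l j) * p i' j)"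
      using R r p[OF i'] that(2)
      by (intro completion_le_release_plus_load[OF ps i']) (auto intro: order_trans)
    also have "\<dots> \<le> R + (\<Sum>j\<in>?C. Max ((\<lambda>i. p i j) ` {1..m}))"
      using p that(2) by (intro add_left_mono load_le_sum_max_time[OF ps i']) auto
    finally show ?thesis using late by linarith
  qed
  \<comment> \<open>Every machine is free by \<open>rlo L < rhi L\<close>, so \<open>L\<close>
    starts at \<open>rhi L\<close> on each of them. Comparing completion times therefore amounts to
    comparing processing times of \<open>L\<close>.\<close>
  have ext: "append_completion n p y (extreme_scenario n rlo rhi L) L i' = p i' L + rhi L"
    if i': "i' \<in> {1..m}" for i'
  proof -
    have "completion n p y (extreme_scenario n rlo rhi L) i' (njobs n y i') \<le> rlo L"
      using N[OF i'] lt by (intro early[OF i']) (auto simp: extreme_scenario_def intro: less_imp_le)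
    moreover have "extreme_scenario n rlo rhi L L = rhi L"
      using L by (simp add: extreme_scenario_def)
    ultimately show ?thesis
      using completion_append_job_last[OF ps _ L i' N[OF i']] lt[OF L]
      by (simp add: append_completion_def max_def)
  qed
  have q: "p i L \<le> p i' L" if "i' \<in> {1..m}" for i'
    using *(7) ext[OF that] ext[OF *(6)] that by (fastforce simp: v)
  have "makespan n m p x r \<le> r L + p i L" if r: "r \<in> scenarios n rlo rhi" for r
  proof -
    have rj: "rlo t \<le> r t" "r t \<le> rhi t" if "t \<in> {1..n}" for t
      using r that by (auto simp: scenarios_def PiE_iff)
    have "completion n p x r i' (njobs n x i') \<le> r L + p i L" if i': "i' \<in> {1..m}" for i'
    proof -
      have e: "completion n p y r i' (njobs n y i') \<le> r L"
        using early[OF i', of "njobs n y i'" r] N[OF i'] rj rj(1)[OF L] by force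
      have nj: "njobs n x i' = njobs n y i' + (if i' = i then 1 else 0)"
        using njobs_append_job[OF ps _ L N[OF *(6)]] *(1) v by simp
      \<comment> \<open>On machine \<open>i\<close> the last job is \<open>L\<close>, started
        exactly at \<open>r L\<close>. Any other machine is unchanged from \<open>y\<close> and done
        by \<open>r L\<close>, and \<open>p i L \<ge> 0\<close>.\<close>
      show ?thesis
      proof (cases "i' = i")
        case True
        then show ?thesis
          using completion_append_job_last[OF ps _ L i' N[OF i'], of p r] e nj *(1) v by simp
      next
        case False
        then have "completion n p x r i' (njobs n x i') = completion n p y r i' (njobs n y i')"
          using nj by (simp, intro completion_cong) (auto simp: *(1) append_job_def)
        then show ?thesis
          using e p[OF *(6) L] by linarith
      qed
    qed
    then show ?thesis
      unfolding makespan_def using m by (subst Max_le_iff) auto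
  qed
  then show ?thesis
    using that sched q by blast
qed

section \<open>Zero regret of the output and optimality\<close>

theorem mainTheorem3:
  fixes n m :: nat
    and p :: "nat \<Rightarrow> nat \<Rightarrow> real"
    and rlo rhi :: "nat \<Rightarrow> real"
    and xPM :: schedule
  assumes "n \<ge> 2" and "m \<ge> 1"
    and "\<forall>i\<in>{1..m}. \<forall>j\<in>{1..n}. p i j > 0"
    and "\<forall>j\<in>{1..n}. 0 \<le> rlo j \<and> rlo j < rhi j"
    and "\<exists>j\<in>{1..n}.
           Max (rhi ` ({1..n} - {j})) + (\<Sum>k\<in>{1..n} - {j}. Max ((\<lambda>i. p i k) ` {1..m})) \<le> rlo j"
    and "pm_output n m p rlo rhi xPM"
  shows "xPM \<in> schedules n m \<and>
         worst_regret n m p rlo rhi xPM = Min (worst_regret n m p rlo rhi ` schedules n m)"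
proof -
  from assms(5) obtain L where L: "L \<in> {1..n}"
    and late: "Max (rhi ` ({1..n} - {L})) + (\<Sum>k\<in>{1..n} - {L}. Max ((\<lambda>i. p i k) ` {1..m})) \<le> rlo L"
    by blast
  define R where "R = Max (rhi ` ({1..n} - {L}))"
  have RU: "rhi t \<le> R" if "t \<in> {1..n} - {L}" for t
    unfolding R_def using that by (intro Max_ge) auto
  \<comment> \<open>With \<open>n \<ge> 2\<close>, one of the jobs 1 and 2 differs from
    \<open>L\<close>. Its upper release date is positive, which yields
    \<open>R \<ge> 0\<close>.\<close>
  have "{1..n} - {L} \<noteq> {}"
  proof -
    have "1 \<in> {1..n} - {L} \<or> 2 \<in> {1..n} - {L}"
      using assms(1) by auto
    then show ?thesis by blast
  qed
  then obtain t where "t \<in> {1..n} - {L}"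
    by blast
  then have R0: "R \<ge> 0"
    using RU[of t] assms(4) by force
  have p: "p i j \<ge> 0" if "i \<in> {1..m}" "j \<in> {1..n}" for i j
    using assms(3) that by (simp add: less_imp_le)
  obtain q where x: "xPM \<in> schedules n m" and q: "\<And>i. i \<in> {1..m} \<Longrightarrow> q \<le> p i L"
    and mk: "\<And>r. r \<in> scenarios n rlo rhi \<Longrightarrow> makespan n m p xPM r \<le> r L + q"
    using pm_output_makespan[OF assms(6) _ assms(2) L p _ R0 RU] late assms(1,4) R_def by auto
  have lower: "r L + q \<le> makespan n m p y r" if "y \<in> schedules n m" for y r
    using that L p q by (intro makespan_ge_release_plus_min_time) auto
  \<comment> \<open>The lower bound valid for all schedules is attained by \<open>xPM\<close>, in
    every scenario at once.\<close>
  have opt: "opt_makespan n m p r = r L + q" if r: "r \<in> scenarios n rlo rhi" for r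
    unfolding opt_makespan_def
  proof (rule Min_eqI)
    show "r L + q \<in> (\<lambda>x. makespan n m p x r) ` schedules n m"
      using antisym[OF mk[OF r] lower[OF x]] x by (intro image_eqI[of _ _ xPM]) auto
  qed (use lower finite_schedules in auto)
  have reg0: "regret n m p xPM r = 0" if "r \<in> scenarios n rlo rhi" for r
    unfolding regret_def opt[OF that] using antisym[OF mk[OF that] lower[OF x]] by simp
  \<comment> \<open>Any scenario would do: \<open>r0\<close> shows that the supremum is over a
    nonempty set, and it is the point at which the regret of a competitor is evaluated.\<close>
  define r0 where "r0 = (\<lambda>j\<in>{1..n}. rlo j)"
  have r0: "r0 \<in> scenarios n rlo rhi"
    using assms(4) by (auto simp: r0_def scenarios_def intro: less_imp_le)
  have Z0: "worst_regret n m p rlo rhi xPM = 0"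
  proof -
    have "worst_regret n m p rlo rhi xPM = (SUP r\<in>scenarios n rlo rhi. 0 :: real)"
      unfolding worst_regret_def using reg0 by (intro SUP_cong) auto
    then show ?thesis
      using r0 by (subst (asm) cSUP_const) auto
  qed
  have Zpos: "0 \<le> worst_regret n m p rlo rhi y" if y: "y \<in> schedules n m" for y
  proof -
    \<comment> \<open>A real supremum dominates its members only if the set is bounded above, so a
      uniform bound is needed: the makespan is largest at \<open>rhi\<close>, the optimum smallest
      at \<open>r L = rlo L\<close>. Here \<open>rhi\<close> need not vanish or be undefined outside
      \<open>{1..n}\<close>, since only the values on jobs enter the comparison.\<close>
    have "regret n m p y r \<le> makespan n m p y rhi - (rlo L + q)" if r: "r \<in> scenarios n rlo rhi" for r
    proof -
      have rj: "rlo t \<le> r t" "r t \<le> rhi t" if "t \<in> {1..n}" for t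
        using r that by (auto simp: scenarios_def PiE_iff)
      have "makespan n m p y r \<le> makespan n m p y rhi"
        using rj assms(2) by (intro makespan_mono_scenario) auto
      then show ?thesis
        unfolding regret_def opt[OF r] using rj(1)[OF L] by linarith
    qed
    then have "bdd_above (regret n m p y ` scenarios n rlo rhi)"
      by (intro bdd_aboveI2)
    then have "regret n m p y r0 \<le> worst_regret n m p rlo rhi y"
      unfolding worst_regret_def using r0 by (rule cSUP_upper[rotated])
    moreover have "0 \<le> regret n m p y r0"
      unfolding regret_def opt[OF r0] using lower[OF y, of r0] by linarith
    ultimately show ?thesis by linarith
  qed
  have "Min (worst_regret n m p rlo rhi ` schedules n m) = 0"
    using Zpos finite_schedules x by (intro Min_eqI) (auto simp: Z0[symmetric])
  then show ?thesis
    using x Z0 by simp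
qed

end
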